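(* Let $F$ be a finite field, $\Gamma$ a nonempty set, $\varphi:\Gamma\to\Gamma$ a self-map, $\mathfrak{w}=(\mathfrak{w}_\alpha)_{\alpha\in\Gamma}\in F^\Gamma$, and let $\sigma_{\varphi,\mathfrak{w}}:F^\Gamma\to F^\Gamma$, $\sigma_{\varphi,\mathfrak{w}}((x_\alpha)_{\alpha\in\Gamma})=(\mathfrak{w}_\alpha x_{\varphi(\alpha)})_{\alpha\in\Gamma}$. Then $\sigma_{\varphi,\mathfrak{w}}$ is quasi-periodic if and only if it is pointwise quasi-periodic.
   Context: A self-map $f:A\to A$ is quasi-periodic if there exist $n>m\geq1$ with $f^n=f^m$. It is pointwise quasi-periodic if for every $x\in A$ there exist $m>n\geq1$ (depending on $x$) with $f^n(x)=f^m(x)$. *)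

theory Defs
  imports Main
begin

definition quasi_periodic :: "('a \<Rightarrow> 'a) \<Rightarrow> bool" where
  "quasi_periodic f \<longleftrightarrow> (\<exists>n m. n > m \<and> m \<ge> 1 \<and> f ^^ n = f ^^ m)"

definition pointwise_quasi_periodic :: "('a \<Rightarrow> 'a) \<Rightarrow> bool" where
  "pointwise_quasi_periodic f \<longleftrightarrow>
     (\<forall>x. \<exists>m n. m > n \<and> n \<ge> 1 \<and> (f ^^ n) x = (f ^^ m) x)"

definition weighted_generalized_shift ::
  "('g \<Rightarrow> 'g) \<Rightarrow> ('g \<Rightarrow> 'k::times) \<Rightarrow> ('g \<Rightarrow> 'k) \<Rightarrow> ('g \<Rightarrow> 'k)" where
  "weighted_generalized_shift \<phi> w x = (\<lambda>\<alpha>. w \<alpha> * x (\<phi> \<alpha>))"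

end

(*
  For n = 0, 1, 2, ... the sets B n = {x. f^(n! + n) x = f^n x} form an increasing chain of closed
  subgroups of the compact group F^\<Gamma>, and a point is quasi-periodic iff it lies in some B n.
  If the B n cover F^\<Gamma>, then by Baire some B n has interior, so it contains every x that
  vanishes on a suitable finite S.  The finitely many x supported on S also lie in a common
  B m, and these two kinds of elements generate F^\<Gamma>.
*)
theory Submission
  imports Defs "HOL-Analysis.Urysohn"
begin

text \<open>The point \<open>(f ^^ n) x\<close> is fixed by \<open>f ^^ p\<close>, hence by
  \<open>f ^^ q\<close>; applying \<open>f\<close> another \<open>k - n\<close> times carries this
  to time \<open>k\<close>.\<close>

lemma funpow_eventual_period:
  fixes f :: "'a \<Rightarrow> 'a"
  assumes "(f ^^ (p + n)) x = (f ^^ n) x" "n \<le> k" "p dvd q"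
  shows "(f ^^ (q + k)) x = (f ^^ k) x"
proof -
  obtain c where q: "q = c * p"
    using assms(3) by (metis dvd_def mult.commute)
  have "(f ^^ (c * p)) ((f ^^ n) x) = (f ^^ n) x" for c
  proof (induction c)
    case (Suc c)
    have "(f ^^ p) ((f ^^ n) x) = (f ^^ n) x"
      using assms(1) by (simp add: funpow_add)
    with Suc show ?case
      by (simp add: funpow_add add.commute[of p])
  qed simp
  then have "(f ^^ ((k - n) + (q + n))) x = (f ^^ ((k - n) + n)) x"
    by (simp add: funpow_add q)
  then show ?thesis
    using assms(2) by (simp add: add.commute add.left_commute)
qed

text \<open>One index bounds both preperiod and period: \<open>fact n\<close> is a multiple of every
  period from 1 to \<open>n\<close>. This makes the sets a chain.\<close>

definition period_set :: "('a \<Rightarrow> 'a) \<Rightarrow> nat \<Rightarrow> 'a set" where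
  "period_set f n = {x. (f ^^ (fact n + n)) x = (f ^^ n) x}"

lemma mono_period_set: "mono (period_set f)"
proof (rule monoI, rule subsetI)
  fix m n :: nat and x
  assume "m \<le> n" "x \<in> period_set f m"
  then show "x \<in> period_set f n"
    using funpow_eventual_period[of "fact m" m f x n "fact n"] fact_dvd[of m n]
    by (simp add: period_set_def)
qed

lemma in_period_set:
  assumes "(f ^^ n) x = (f ^^ m) x" "n < m"
  shows "x \<in> period_set f m"
proof -
  have "(m - n) dvd fact m"
    using assms(2) by (intro dvd_fact) auto
  then show ?thesis
    using assms funpow_eventual_period[of "m - n" n f x m "fact m"] by (simp add: period_set_def)
qed

lemma pointwise_quasi_periodic_imp_covered:
  assumes "pointwise_quasi_periodic f"
  shows "(\<Union>n. period_set f n) = UNIV"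
  using assms in_period_set unfolding pointwise_quasi_periodic_def by fast

lemma quasi_periodic_imp_pointwise:
  "quasi_periodic f \<Longrightarrow> pointwise_quasi_periodic f"
  unfolding quasi_periodic_def pointwise_quasi_periodic_def by metis

lemma quasi_periodic_if_period_set_UNIV:
  assumes "period_set f n = UNIV"
  shows "quasi_periodic f"
proof -
  \<comment> \<open>\<open>n\<close> may be 0, while \<open>quasi_periodic\<close> asks for a
    positive smaller exponent, hence the move to \<open>Suc n\<close>.\<close>
  have "f ^^ (fact (Suc n) + Suc n) = f ^^ Suc n"
    using assms monoD[OF mono_period_set, of n "Suc n" f]
    by (auto simp: period_set_def fun_eq_iff simp del: funpow.simps fact_Suc)
  moreover have "fact (Suc n) + Suc n > Suc n"
    using fact_gt_zero[of "Suc n", where ?'a = nat] by linarith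
  ultimately show ?thesis
    unfolding quasi_periodic_def by (metis One_nat_def Suc_le_mono le0)
qed

lemma finite_subset_chain_member:
  fixes B :: "nat \<Rightarrow> 'a set"
  assumes "mono B" "finite R" "R \<subseteq> (\<Union>n. B n)"
  shows "\<exists>n. R \<subseteq> B n"
  using assms(2,3)
proof (induction R)
  case (insert r R)
  then obtain m n where "R \<subseteq> B m" "r \<in> B n"
    by auto
  then have "insert r R \<subseteq> B (max m n)"
    using monoD[OF assms(1), of m "max m n"] monoD[OF assms(1), of n "max m n"] by auto
  then show ?case ..
qed simp

abbreviation cantor_topology :: "('g \<Rightarrow> 'k) topology" where
  "cantor_topology \<equiv> product_topology (\<lambda>_. discrete_topology UNIV) UNIV"

lemma topspace_cantor [simp]: "topspace cantor_topology = UNIV"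
  by simp

lemma Hausdorff_cantor: "Hausdorff_space cantor_topology"
  by (simp add: Hausdorff_space_product_topology)

lemma compact_cantor: "compact_space (cantor_topology :: ('g \<Rightarrow> 'k::finite) topology)"
  by (simp add: compact_space_product_topology compact_space_discrete_topology)

text \<open>A basic open box restricts only finitely many coordinates; these form
  \<open>S\<close>.\<close>

lemma cantor_neighbourhood:
  assumes "openin cantor_topology U" "a \<in> U"
  shows "\<exists>S. finite S \<and> (\<forall>y. (\<forall>i\<in>S. y i = a i) \<longrightarrow> y \<in> U)"
proof -
  obtain X where X: "a \<in> Pi\<^sub>E UNIV X" "finite {i. X i \<noteq> UNIV}" "Pi\<^sub>E UNIV X \<subseteq> U"
    using product_topology_open_contains_basis[OF assms] by auto
  have "y \<in> U" if "\<forall>i\<in>{i. X i \<noteq> UNIV}. y i = a i" for y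
  proof -
    have "y i \<in> X i" for i
      using that X(1) by (cases "X i = UNIV") (auto simp: PiE_iff)
    then show ?thesis
      using X(3) by (auto simp: PiE_iff)
  qed
  with X(2) show ?thesis by blast
qed

theorem Baire_additive_chain:
  fixes B :: "nat \<Rightarrow> ('g \<Rightarrow> 'k::{ab_group_add, finite}) set"
  assumes mono: "mono B"
    and closed: "\<And>n. closedin cantor_topology (B n)"
    and add: "\<And>n x y. x \<in> B n \<Longrightarrow> y \<in> B n \<Longrightarrow> (\<lambda>i. x i + y i) \<in> B n"
    and diff: "\<And>n x y. x \<in> B n \<Longrightarrow> y \<in> B n \<Longrightarrow> (\<lambda>i. x i - y i) \<in> B n"
    and cover: "(\<Union>n. B n) = UNIV"
  shows "\<exists>n. B n = UNIV"
proof -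
  have "\<exists>n. cantor_topology interior_of B n \<noteq> {}"
  proof (rule ccontr)
    assume "\<not> ?thesis"
    then have "(cantor_topology :: ('g \<Rightarrow> 'k) topology) interior_of \<Union>(range B) = {}"
      using closed compact_cantor Hausdorff_cantor
      \<comment> \<open>\<open>disjI2\<close> selects the locally compact regular case of Baire's
        theorem.\<close>
      by (intro Baire_category_alt disjI2)
        (auto intro: compact_imp_locally_compact_space compact_Hausdorff_imp_regular_space)
    with cover show False
      using interior_of_topspace[of "cantor_topology :: ('g \<Rightarrow> 'k) topology"] by simp
  qed
  then obtain n a where a: "a \<in> cantor_topology interior_of B n"
    by blast
  then obtain S where S: "finite S" "\<And>y. \<forall>i\<in>S. y i = a i \<Longrightarrow> y \<in> B n"
    using cantor_neighbourhood[OF openin_interior_of a] interior_of_subset by (metis subsetD)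
  \<comment> \<open>The functions supported on \<open>S\<close>, written in the shape that
    \<open>finite_set_of_finite_funs\<close> expects.\<close>
  define R :: "('g \<Rightarrow> 'k) set"
    where "R = {r. \<forall>i. (i \<in> S \<longrightarrow> r i \<in> UNIV) \<and> (i \<notin> S \<longrightarrow> r i = 0)}"
  have "finite R"
    unfolding R_def using S(1) by (intro finite_set_of_finite_funs) auto
  then obtain m where m: "R \<subseteq> B m"
    using finite_subset_chain_member[OF mono, of R] cover by auto
  have sub: "B n \<subseteq> B (max m n)" "B m \<subseteq> B (max m n)"
    using monoD[OF mono] by auto
  have "x \<in> B (max m n)" for x
  proof -
    define r where "r = (\<lambda>i. if i \<in> S then x i else 0)"
    have "r \<in> R"
      by (simp add: R_def r_def)
    then have r: "r \<in> B (max m n)"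
      using m sub(2) by blast
    \<comment> \<open>\<open>x - r\<close> vanishes on \<open>S\<close>, so adding \<open>a\<close>
      gives a point that agrees with \<open>a\<close> there; subtracting \<open>a\<close> again
      stays in the subgroup.\<close>
    have "(\<lambda>i. x i - r i + a i) \<in> B n" "a \<in> B n"
      using S(2) by (simp_all add: r_def)
    from diff[OF this] have "(\<lambda>i. x i - r i) \<in> B (max m n)"
      using sub(1) by auto
    from add[OF r this] show ?thesis
      by simp
  qed
  then show ?thesis by blast
qed

text \<open>The set is the equalizer of two continuous iterates into a Hausdorff space.\<close>

lemma closedin_period_set:
  assumes "Hausdorff_space X" "continuous_map X X f" "topspace X = UNIV"
  shows "closedin X (period_set f n)"
proof -
  have "continuous_map X X (f ^^ k)" for k
  proof (induction k)
    case (Suc k)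
    then show ?case
      unfolding funpow.simps by (rule continuous_map_compose[OF _ assms(2)])
  qed (simp add: id_def)
  from closedin_continuous_maps_eq[OF assms(1) this this] show ?thesis
    by (simp add: period_set_def assms(3))
qed

text \<open>Iterates of an additive map are additive, so each \<open>period_set f n\<close> is
  closed under sums and differences, as \<open>Baire_additive_chain\<close> requires.\<close>

theorem quasi_periodic_iff_pointwise_if_additive:
  fixes f :: "('g \<Rightarrow> 'k::{ab_group_add, finite}) \<Rightarrow> ('g \<Rightarrow> 'k)"
  assumes cont: "continuous_map cantor_topology cantor_topology f"
    and add: "\<And>x y. f (\<lambda>i. x i + y i) = (\<lambda>i. f x i + f y i)"
    and diff: "\<And>x y. f (\<lambda>i. x i - y i) = (\<lambda>i. f x i - f y i)"
  shows "quasi_periodic f \<longleftrightarrow> pointwise_quasi_periodic f"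
proof
  assume "pointwise_quasi_periodic f"
  moreover have "(f ^^ k) (\<lambda>i. x i + y i) = (\<lambda>i. (f ^^ k) x i + (f ^^ k) y i)"
    "(f ^^ k) (\<lambda>i. x i - y i) = (\<lambda>i. (f ^^ k) x i - (f ^^ k) y i)" for k x y
    by (induction k) (auto simp: add diff)
  ultimately have "\<exists>n. period_set f n = UNIV"
    by (intro Baire_additive_chain mono_period_set closedin_period_set Hausdorff_cantor cont
        topspace_cantor pointwise_quasi_periodic_imp_covered) (auto simp: period_set_def)
  then show "quasi_periodic f"
    using quasi_periodic_if_period_set_UNIV by blast
qed (rule quasi_periodic_imp_pointwise)

text \<open>Each output coordinate is a projection followed by a map between discrete
  spaces.\<close>

lemma continuous_map_weighted_generalized_shift:
  "continuous_map cantor_topology cantor_topology (weighted_generalized_shift \<phi> w)"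
  unfolding weighted_generalized_shift_def continuous_map_componentwise_UNIV
proof
  fix \<alpha>
  have "continuous_map cantor_topology (discrete_topology UNIV) ((\<lambda>c. w \<alpha> * c) \<circ> (\<lambda>x. x (\<phi> \<alpha>)))"
    by (rule continuous_map_compose[OF continuous_map_product_projection]) auto
  then show "continuous_map cantor_topology (discrete_topology UNIV) (\<lambda>x. w \<alpha> * x (\<phi> \<alpha>))"
    by (simp add: o_def)
qed

text \<open>The index set is the type \<open>'g\<close>, nonempty like every type; additivity of the
  shift is distributivity in the field.\<close>

theorem corollary3p5:
  fixes \<phi> :: "'g \<Rightarrow> 'g"
    and w :: "'g \<Rightarrow> 'k::{field, finite}"
  shows "quasi_periodic (weighted_generalized_shift \<phi> w) \<longleftrightarrow>
         pointwise_quasi_periodic (weighted_generalized_shift \<phi> w)"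
  by (rule quasi_periodic_iff_pointwise_if_additive[OF continuous_map_weighted_generalized_shift])
    (simp_all add: weighted_generalized_shift_def algebra_simps)

end
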